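(* Let $\mathcal{T}=(t_{ijkl})$ be a real 4th-order 3-dimensional cyclic symmetric tensor. Suppose $t_{1123}\in\left(-\frac{7}{12},-\frac16\right]$, $|t_{1112}|=|t_{1222}|=t_{1122}=t_{1111}=1$ and $t_{1112}t_{1222}=-1$. Then $\mathcal{T}$ is positive definite.
   Context: A 4th-order 3-dimensional real tensor $\mathcal{T}=(t_{ijkl})_{1\le i,j,k,l\le 3}$ is symmetric if its entries are invariant under all permutations of the indices. It is cyclic symmetric if it is symmetric and $t_{1111}=t_{2222}=t_{3333}$, $t_{1112}=t_{2223}=t_{1333}$, $t_{1113}=t_{1222}=t_{2333}$, $t_{1122}=t_{1133}=t_{2233}$, $t_{1123}=t_{1223}=t_{1233}$. For $x\in\mathbb{R}^3$, $\mathcal{T}x^4=\sum_{i,j,k,l=1}^3 t_{ijkl}x_ix_jx_kx_l$. $\mathcal{T}$ is positive definite if $\mathcal{T}x^4> 0$ for all $x\in\mathbb{R}^3\setminus\{0\}$. *)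

theory Defs
  imports "HOL-Analysis.Analysis"
begin

text \<open>A 4th-order tensor with entries \<open>t i j k l\<close>; the index type is \<open>'n\<close>. For dimension 3 the
  index type is \<open>3\<close>, whose elements are \<open>1, 2, 3\<close> (the numeral \<open>3 :: 3\<close> coincides with \<open>0\<close>), as for
  the components of a vector of type \<^typ>\<open>real ^ 3\<close>.\<close>

type_synonym 'n tensor4 = "'n \<Rightarrow> 'n \<Rightarrow> 'n \<Rightarrow> 'n \<Rightarrow> real"

definition symmetric_tensor4 :: "'n tensor4 \<Rightarrow> bool" where
  "symmetric_tensor4 t \<longleftrightarrow>
     (\<forall>(i :: nat \<Rightarrow> 'n) \<pi>. \<pi> permutes {1..4} \<longrightarrow>
        t (i (\<pi> 1)) (i (\<pi> 2)) (i (\<pi> 3)) (i (\<pi> 4)) = t (i 1) (i 2) (i 3) (i 4))"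

definition cyclic_symmetric_tensor4 :: "3 tensor4 \<Rightarrow> bool" where
  "cyclic_symmetric_tensor4 t \<longleftrightarrow>
     symmetric_tensor4 t \<and>
     t 1 1 1 1 = t 2 2 2 2 \<and> t 2 2 2 2 = t 3 3 3 3 \<and>
     t 1 1 1 2 = t 2 2 2 3 \<and> t 2 2 2 3 = t 1 3 3 3 \<and>
     t 1 1 1 3 = t 1 2 2 2 \<and> t 1 2 2 2 = t 2 3 3 3 \<and>
     t 1 1 2 2 = t 1 1 3 3 \<and> t 1 1 3 3 = t 2 2 3 3 \<and>
     t 1 1 2 3 = t 1 2 2 3 \<and> t 1 2 2 3 = t 1 2 3 3"

definition tensor4_form :: "'n::finite tensor4 \<Rightarrow> real ^ 'n \<Rightarrow> real" where
  "tensor4_form t x =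
     (\<Sum>i\<in>UNIV. \<Sum>j\<in>UNIV. \<Sum>k\<in>UNIV. \<Sum>l\<in>UNIV. t i j k l * x $ i * x $ j * x $ k * x $ l)"

definition positive_definite_tensor4 :: "'n::finite tensor4 \<Rightarrow> bool" where
  "positive_definite_tensor4 t \<longleftrightarrow> (\<forall>x. x \<noteq> 0 \<longrightarrow> tensor4_form t x > 0)"

end

theory Submission
  imports Defs
begin

text \<open>Put \<open>c = t 1 1 2 3\<close> and \<open>a = t 1 1 1 2\<close>, so that \<open>t 1 2 2 2 = - a\<close> and \<open>a\<close> is \<open>1\<close> or \<open>- 1\<close>.
  Expanding the form gives the cyclic ternary quartic
  \[ \sum x^4 + 4 a \sum x^3 (y - z) + 6 \sum x^2 y^2 + 12 c\, x y z (x + y + z), \]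
  where the sums are cyclic. Exchanging \<open>y\<close> and \<open>z\<close> changes the sign of the second sum only, hence
  \<open>a = 1\<close> may be assumed.

  For \<open>a = 1\<close> this quartic is a nonnegative combination of squares. Completing the square in
  \<open>x\<^sup>2\<close>, \<open>y\<^sup>2\<close>, \<open>z\<^sup>2\<close> absorbs the fourth powers and the terms \<open>x\<^sup>3 y\<close>; what is left is a symmetric
  quadratic form in \<open>x y\<close>, \<open>y z\<close>, \<open>z x\<close>, with eigenvalue \<open>12 c + 7\<close> on the span of \<open>(1, 1, 1)\<close> and
  \<open>- (6 c + 1)\<close> on its orthogonal complement. These two eigenvalues are where the bounds
  \<open>- 7 / 12 < c\<close> and \<open>c \<le> - 1 / 6\<close> enter (lemma \<open>cyclic_quartic_sum_of_squares\<close>).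
  Since the second eigenvalue vanishes at \<open>c = - 1 / 6\<close>, strictness has to come from the squares
  whose coefficients stay positive there: their only common zero is the origin
  (lemma \<open>common_zero_of_squares\<close>).\<close>

section \<open>The cyclic quartic\<close>

definition cyclic_quartic :: "real \<Rightarrow> real \<Rightarrow> real \<Rightarrow> real \<Rightarrow> real \<Rightarrow> real" where
  "cyclic_quartic a c x y z =
     x^4 + y^4 + z^4 + 4 * a * (x^3 * (y - z) + y^3 * (z - x) + z^3 * (x - y))
     + 6 * (x^2 * y^2 + y^2 * z^2 + z^2 * x^2) + 12 * c * (x * y * z * (x + y + z))"

lemma cyclic_quartic_swap: "cyclic_quartic (- a) c x y z = cyclic_quartic a c x z y"
  unfolding cyclic_quartic_def by (simp add: power_numeral_reduce algebra_simps)

text \<open>The squares come from a Gram matrix, chosen invariant under the cyclic shift, for the monomials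
  \<open>x\<^sup>2, y\<^sup>2, z\<^sup>2, y z, z x, x y\<close>. Its block on \<open>x\<^sup>2, y\<^sup>2, z\<^sup>2\<close> has diagonal entries \<open>1\<close>; taking the
  off-diagonal ones to be \<open>- 1 / 2\<close> makes it singular exactly along \<open>(1, 1, 1)\<close>. This is consistent
  because every \<open>x\<^sup>2\<close> is paired with a multiple of \<open>x y - z x\<close>, and these differences add up to
  zero. The choice works for the whole range of \<open>c\<close> at once.\<close>

lemma cyclic_quartic_sum_of_squares:
  "6 * cyclic_quartic 1 c x y z =
     (2 * x^2 - y^2 - z^2 + 4 * x * (y - z))^2
     + (2 * y^2 - z^2 - x^2 + 4 * y * (z - x))^2
     + (2 * z^2 - x^2 - y^2 + 4 * z * (x - y))^2
     + 2 * (12 * c + 7) * (x * y + y * z + z * x)^2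
     - 2 * (6 * c + 1) * ((x * y - y * z)^2 + (y * z - z * x)^2 + (z * x - x * y)^2)"
  unfolding cyclic_quartic_def by (simp add: power_numeral_reduce algebra_simps)

text \<open>Where \<open>x y + y z + z x\<close> vanishes, \<open>x\<^sup>2 + y\<^sup>2 + z\<^sup>2 = (x + y + z)\<^sup>2\<close>, so it suffices that
  \<open>s = x + y + z\<close> is zero, and the equations become \<open>3 x\<^sup>2 + 4 x (y - z) = s\<^sup>2\<close> and its cyclic shifts.
  Weighting them by \<open>y z\<close>, \<open>z x\<close>, \<open>x y\<close> cancels all but \<open>3 x y z s = 0\<close>. If instead of \<open>s\<close> one of the
  coordinates is zero, the equation led by that coordinate reads \<open>0 = s\<^sup>2\<close>.\<close>

lemma common_zero_of_squares:
  fixes x y z :: real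
  assumes "x * y + y * z + z * x = 0"
    and "2 * x^2 - y^2 - z^2 + 4 * x * (y - z) = 0"
    and "2 * y^2 - z^2 - x^2 + 4 * y * (z - x) = 0"
    and "2 * z^2 - x^2 - y^2 + 4 * z * (x - y) = 0"
  shows "x = 0 \<and> y = 0 \<and> z = 0"
proof -
  let ?s = "x + y + z"
  have norm: "x^2 + y^2 + z^2 = ?s^2"
    using assms(1) by algebra
  have eq_x: "x * (3 * x + 4 * (y - z)) = ?s^2"
    and eq_y: "y * (3 * y + 4 * (z - x)) = ?s^2"
    and eq_z: "z * (3 * z + 4 * (x - y)) = ?s^2"
    using assms by algebra+
  have "y * z * (x * (3 * x + 4 * (y - z))) + z * x * (y * (3 * y + 4 * (z - x)))
      + x * y * (z * (3 * z + 4 * (x - y))) = 3 * (x * y * z * ?s)"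
    by (simp add: algebra_simps)
  then have "3 * (x * y * z * ?s) = ?s^2 * (x * y + y * z + z * x)"
    unfolding eq_x eq_y eq_z by (simp add: algebra_simps)
  then have "x * y * z * ?s = 0"
    using assms(1) by simp
  then have "?s^2 = 0"
    using eq_x eq_y eq_z by auto
  then show ?thesis
    using norm by (smt (verit) zero_le_power2 power2_eq_square mult_eq_0_iff)
qed

lemma cyclic_quartic_pos:
  assumes "- (7/12) < c" and "c \<le> - (1/6)" and nonzero: "\<not> (x = 0 \<and> y = 0 \<and> z = 0)"
  shows "0 < cyclic_quartic 1 c x y z"
proof -
  define A B C S D where
    "A = 2 * x^2 - y^2 - z^2 + 4 * x * (y - z)"
    and "B = 2 * y^2 - z^2 - x^2 + 4 * y * (z - x)"
    and "C = 2 * z^2 - x^2 - y^2 + 4 * z * (x - y)"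
    and "S = x * y + y * z + z * x"
    and "D = (x * y - y * z)^2 + (y * z - z * x)^2 + (z * x - x * y)^2"
  have sos: "6 * cyclic_quartic 1 c x y z =
      A^2 + B^2 + C^2 + 2 * (12 * c + 7) * S^2 - 2 * (6 * c + 1) * D"
    unfolding A_def B_def C_def S_def D_def by (rule cyclic_quartic_sum_of_squares)
  have "A \<noteq> 0 \<or> B \<noteq> 0 \<or> C \<noteq> 0 \<or> S \<noteq> 0"
    using common_zero_of_squares[of x y z] nonzero
    unfolding A_def B_def C_def S_def by blast
  then have "0 < A^2 \<or> 0 < B^2 \<or> 0 < C^2 \<or> 0 < 2 * (12 * c + 7) * S^2"
    using assms(1) by simp
  moreover have "0 \<le> 2 * (12 * c + 7) * S^2"
    using assms(1) by simp
  moreover have "0 \<le> A^2" "0 \<le> B^2" "0 \<le> C^2"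
    by simp_all
  moreover have "2 * (6 * c + 1) \<le> 0" "0 \<le> D"
    using assms(2) by (simp_all add: D_def)
  then have "2 * (6 * c + 1) * D \<le> 0"
    by (rule mult_nonpos_nonneg)
  ultimately show ?thesis
    using sos by linarith
qed

section \<open>The form of a cyclic symmetric tensor\<close>

text \<open>Adjacent transpositions generate all permutations, and as rewrite rules these three equations
  sort the indices of an entry.\<close>

lemma symmetric_tensor4_swap:
  assumes "symmetric_tensor4 t"
  shows "t j i k l = t i j k l" and "t i k j l = t i j k l" and "t i j l k = t i j k l"
proof -
  define f where "f = (\<lambda>n::nat. if n = 1 then i else if n = 2 then j else if n = 3 then k else l)"
  have "t (f (\<pi> 1)) (f (\<pi> 2)) (f (\<pi> 3)) (f (\<pi> 4)) = t (f 1) (f 2) (f 3) (f 4)"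
    if "\<pi> permutes {1..4}" for \<pi>
    using assms that unfolding symmetric_tensor4_def by blast
  then have swap: "t (f (\<pi> 1)) (f (\<pi> 2)) (f (\<pi> 3)) (f (\<pi> 4)) = t i j k l"
    if "\<pi> permutes {1..4}" for \<pi>
    using that unfolding f_def by simp
  show "t j i k l = t i j k l"
    using swap[OF permutes_swap_id[of 1 _ 2]] by (simp add: f_def transpose_def)
  show "t i k j l = t i j k l"
    using swap[OF permutes_swap_id[of 2 _ 3]] by (simp add: f_def transpose_def)
  show "t i j l k = t i j k l"
    using swap[OF permutes_swap_id[of 3 _ 4]] by (simp add: f_def transpose_def)
qed

lemma tensor4_form_cyclic_symmetric:
  assumes "cyclic_symmetric_tensor4 t"
    and "t 1 1 1 1 = 1" and "t 1 1 2 2 = 1" and "t 1 2 2 2 = - t 1 1 1 2"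
  shows "tensor4_form t v = cyclic_quartic (t 1 1 1 2) (t 1 1 2 3) (v $ 1) (v $ 2) (v $ 3)"
proof -
  have sym: "symmetric_tensor4 t"
    using assms(1) by (simp add: cyclic_symmetric_tensor4_def)
  note swap = symmetric_tensor4_swap[OF sym]
  have entries: "t 2 2 2 2 = 1" "t 3 3 3 3 = 1" "t 1 1 3 3 = 1" "t 2 2 3 3 = 1"
    "t 2 2 2 3 = t 1 1 1 2" "t 1 3 3 3 = t 1 1 1 2"
    "t 1 1 1 3 = - t 1 1 1 2" "t 2 3 3 3 = - t 1 1 1 2"
    "t 1 2 2 3 = t 1 1 2 3" "t 1 2 3 3 = t 1 1 2 3"
    using assms unfolding cyclic_symmetric_tensor4_def by auto
  show ?thesis
    unfolding tensor4_form_def sum_3 cyclic_quartic_def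
    by (simp only: swap entries assms(2-4)) (simp add: power_numeral_reduce algebra_simps)
qed

theorem theorem4p4:
  fixes t :: "3 tensor4"
  assumes "cyclic_symmetric_tensor4 t"
    and "t 1 1 2 3 \<in> {- (7/12) <.. - (1/6)}"
    and "\<bar>t 1 1 1 2\<bar> = 1" and "\<bar>t 1 2 2 2\<bar> = 1" and "t 1 1 2 2 = 1" and "t 1 1 1 1 = 1"
    and "t 1 1 1 2 * t 1 2 2 2 = -1"
  shows "positive_definite_tensor4 t"
  unfolding positive_definite_tensor4_def
proof (intro allI impI)
  fix v :: "real ^ 3"
  assume "v \<noteq> 0"
  let ?c = "t 1 1 2 3"
  have nonzero: "\<not> (v $ 1 = 0 \<and> v $ 2 = 0 \<and> v $ 3 = 0)"
    using \<open>v \<noteq> 0\<close> by (auto simp: vec_eq_iff forall_3)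
  have a: "t 1 1 1 2 = 1 \<or> t 1 1 1 2 = - 1"
    using assms(3) by linarith
  then have "t 1 2 2 2 = - t 1 1 1 2"
    using assms(7) by auto
  then have form: "tensor4_form t v = cyclic_quartic (t 1 1 1 2) ?c (v $ 1) (v $ 2) (v $ 3)"
    using tensor4_form_cyclic_symmetric assms(1,5,6) by blast
  have pos: "0 < cyclic_quartic 1 ?c (v $ 1) (v $ 2) (v $ 3)"
    "0 < cyclic_quartic 1 ?c (v $ 1) (v $ 3) (v $ 2)"
    using assms(2) nonzero by (auto intro!: cyclic_quartic_pos)
  from a show "0 < tensor4_form t v"
  proof
    assume "t 1 1 1 2 = 1"
    then show ?thesis
      using form pos(1) by simp
  next
    assume "t 1 1 1 2 = - 1"
    then show ?thesis
      using form pos(2) cyclic_quartic_swap[of 1] by simp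
  qed
qed

end
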